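(* For every integer $d \geq 2$ we have $$C_{f_{\min}}^d = \frac{1}{d} \qquad\text{and}\qquad C_{f_{\max}}^d = \frac{d-1}{d},$$ where for a continuous function $f\colon[0,1]^d\to\mathbb{R}$ $$C_f^d = \sup_{\vartheta \in \mathcal{P}_{\mathrm{ds}}([0,1]^d)} \int_{[0,1]^d} f \, \mathrm{d}\vartheta .$$
   Context: A Borel probability measure $\vartheta$ on $[0,1]^d$ is called $d$-stochastic if all its univariate marginals (push-forwards under the coordinate projections) equal the Lebesgue measure $\lambda$ on $[0,1]$. $\mathcal{P}_{\mathrm{ds}}([0,1]^d)$ denotes the set of all $d$-stochastic measures on $[0,1]^d$. Write $[d]=\{1,\ldots,d\}$. The functions $f_{\min},f_{\max}\colon[0,1]^d\to[0,1]$ are defined for $\mathbf{x}=(x_1,\ldots,x_d)$ by $f_{\min}(\mathbf{x})=\min_{i,j\in[d],\,i\neq j}|x_i-x_j|$ and $f_{\max}(\mathbf{x})=\max_{i,j\in[d],\,i\neq j}|x_i-x_j|$. *)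

theory Defs
  imports "HOL-Probability.Probability"
begin

definition unit_cube :: "(real ^ 'n::finite) set" where
  "unit_cube = {x. \<forall>i. 0 \<le> x $ i \<and> x $ i \<le> 1}"

(* The Lebesgue measure on [0,1], carried by the Borel subsets of [0,1]. *)
definition lambda01 :: "real measure" where
  "lambda01 = restrict_space lborel {0..1}"

definition d_stochastic :: "(real ^ 'n::finite) measure \<Rightarrow> bool" where
  "d_stochastic \<theta> \<longleftrightarrow>
     prob_space \<theta> \<and>
     sets \<theta> = sets (restrict_space borel unit_cube) \<and>
     (\<forall>i. distr \<theta> lambda01 (\<lambda>x. x $ i) = lambda01)"

definition P_ds :: "(real ^ 'n::finite) measure set" where
  "P_ds = {\<theta>. d_stochastic \<theta>}"

(* C f is meant for f continuous on the unit cube: such f is bounded and Borel there, so the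
   integrals exist and form a bounded set of reals, nonempty because P_ds contains the law of
   (U, ..., U) with U uniform on [0,1].  The values of f off the cube play no role, and the
   dimension d is CARD('n). *)
definition C :: "(real ^ 'n::finite \<Rightarrow> real) \<Rightarrow> real" where
  "C f = (SUP \<theta>\<in>P_ds. \<integral>x. f x \<partial>\<theta>)"

definition f_min :: "real ^ 'n::finite \<Rightarrow> real" where
  "f_min x = Min {\<bar>x $ i - x $ j\<bar> | i j. i \<noteq> j}"

definition f_max :: "real ^ 'n::finite \<Rightarrow> real" where
  "f_max x = Max {\<bar>x $ i - x $ j\<bar> | i j. i \<noteq> j}"

end

theory Submission
  imports Defs
begin

text \<open>
  Let \<open>d\<close> be the dimension. Both suprema are attained by one measure: the law of
  \<open>(frac U, frac (U + 1/d), \<dots>, frac (U + (d - 1)/d))\<close> with \<open>U\<close> uniform on the unit interval.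
  Its marginals are uniform because a rotation of the circle preserves Lebesgue measure
  (\<open>distr_lambda01_rotation\<close>), and its \<open>d\<close> coordinates are equally spaced on the circle, so any two
  of them are at distance at least \<open>1/d\<close>.

  The two upper bounds reduce to a single one, since \<open>d\<close> points whose pairwise distances are at
  least \<open>m\<close> spread over a length of at least \<open>(d - 1) m\<close>; that is, \<open>(d - 1) f_min \<le> f_max\<close>
  (\<open>f_min_le_f_max\<close>). The same inequality turns the lower bound for \<open>f_min\<close> into the one for \<open>f_max\<close>.

  The upper bound for \<open>f_max\<close> is an argument by duality: \<open>f_max x\<close> is dominated by a constant
  plus a sum of functions of one coordinate each (\<open>f_max_le_separable\<close>), and the integral of
  such a sum is the same for all \<open>d\<close>-stochastic measures. The one-coordinate function is
  \<open>end_excess (1/d)\<close>, which measures how far a point reaches into the two end intervals of length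
  \<open>1/d\<close>. The bound is tight because under the extremal measure almost surely precisely one
  coordinate lies in each end interval.
\<close>

section \<open>Spread of separated points\<close>

lemma separated_set_spread:
  fixes S :: "real set"
  assumes "finite S" "S \<noteq> {}"
    and "\<And>a b. a \<in> S \<Longrightarrow> b \<in> S \<Longrightarrow> a \<noteq> b \<Longrightarrow> m \<le> \<bar>a - b\<bar>"
  shows "(real (card S) - 1) * m \<le> Max S - Min S"
  using assms
proof (induction S rule: finite_linorder_max_induct)
  case empty
  then show ?case by simp
next
  case (insert b A)
  show ?case
  proof (cases "A = {}")
    case True
    then show ?thesis by simp
  next
    case False
    have IH: "(real (card A) - 1) * m \<le> Max A - Min A"
      using insert.IH[OF False] insert.prems by blast
    have MA: "Max A \<in> A" and mA: "Min A \<in> A"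
      using insert.hyps False by auto
    have b: "Max A < b" "Min A < b" using insert.hyps MA mA by auto
    have "m \<le> \<bar>b - Max A\<bar>"
      using insert.prems(2)[of b "Max A"] MA b by auto
    with b have gap: "m \<le> b - Max A" by simp
    have mx: "Max (insert b A) = b"
      using insert.hyps by (intro Max_eqI) auto
    have mn: "Min (insert b A) = Min A"
      using insert.hyps mA b by (intro Min_eqI) auto
    have "card (insert b A) = Suc (card A)"
      using insert.hyps by (subst card_insert_disjoint) auto
    then show ?thesis
      using IH gap by (simp only: mx mn) (simp add: algebra_simps)
  qed
qed

lemma pairwise_distances_eq_image:
  fixes x :: "real ^ 'n::finite"
  shows "{\<bar>x $ i - x $ j\<bar> | i j. i \<noteq> j} = (\<lambda>p. \<bar>x $ fst p - x $ snd p\<bar>) ` {p. fst p \<noteq> snd p}"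
  by (auto simp: image_def)

lemma finite_pairwise_distances:
  fixes x :: "real ^ 'n::finite"
  shows "finite {\<bar>x $ i - x $ j\<bar> | i j. i \<noteq> j}"
  unfolding pairwise_distances_eq_image by simp

lemma pairwise_distances_nonempty:
  fixes x :: "real ^ 'n::finite"
  assumes "CARD('n) \<ge> 2"
  shows "{\<bar>x $ i - x $ j\<bar> | i j. i \<noteq> j} \<noteq> {}"
proof -
  have "\<not> card (UNIV :: 'n set) \<le> Suc 0" using assms by simp
  then obtain i j :: 'n where "i \<noteq> j"
    by (auto simp: card_le_Suc0_iff_eq)
  then show ?thesis by blast
qed

lemma f_min_le:
  fixes x :: "real ^ 'n::finite"
  shows "i \<noteq> j \<Longrightarrow> f_min x \<le> \<bar>x $ i - x $ j\<bar>"
  unfolding f_min_def by (rule Min_le[OF finite_pairwise_distances]) blast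

lemma le_f_max:
  fixes x :: "real ^ 'n::finite"
  shows "i \<noteq> j \<Longrightarrow> \<bar>x $ i - x $ j\<bar> \<le> f_max x"
  unfolding f_max_def by (rule Max_ge[OF finite_pairwise_distances]) blast

lemma f_min_attained:
  fixes x :: "real ^ 'n::finite"
  assumes "CARD('n) \<ge> 2"
  obtains i j where "i \<noteq> j" "f_min x = \<bar>x $ i - x $ j\<bar>"
  using Min_in[OF finite_pairwise_distances pairwise_distances_nonempty[OF assms], of x]
  unfolding f_min_def by blast

lemma f_max_attained:
  fixes x :: "real ^ 'n::finite"
  assumes "CARD('n) \<ge> 2"
  obtains i j where "i \<noteq> j" "f_max x = \<bar>x $ i - x $ j\<bar>"
  using Max_in[OF finite_pairwise_distances pairwise_distances_nonempty[OF assms], of x]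
  unfolding f_max_def by blast

lemma f_min_le_f_max:
  fixes x :: "real ^ 'n::finite"
  assumes d: "CARD('n) \<ge> 2"
  shows "(real CARD('n) - 1) * f_min x \<le> f_max x"
proof (cases "inj (\<lambda>i. x $ i)")
  case False
  \<comment> \<open>Two coordinates coincide, so \<open>f_min x\<close> vanishes.\<close>
  then obtain i j where ij: "i \<noteq> j" "x $ i = x $ j" unfolding inj_def by blast
  have "f_min x \<le> 0" "0 \<le> f_max x"
    using f_min_le[OF ij(1), of x] le_f_max[OF ij(1), of x] ij(2) by auto
  moreover have "(real CARD('n) - 1) * f_min x \<le> 0"
    using d \<open>f_min x \<le> 0\<close> by (intro mult_nonneg_nonpos) auto
  ultimately show ?thesis by linarith
next
  case True
  let ?S = "range (\<lambda>i. x $ i)"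
  have "f_min x \<le> \<bar>a - b\<bar>" if ab: "a \<in> ?S" "b \<in> ?S" "a \<noteq> b" for a b
  proof -
    obtain i j where "a = x $ i" "b = x $ j" using ab by blast
    moreover from this \<open>a \<noteq> b\<close> have "i \<noteq> j" by blast
    ultimately show ?thesis using f_min_le by blast
  qed
  then have spread: "(real (card ?S) - 1) * f_min x \<le> Max ?S - Min ?S"
    by (intro separated_set_spread) auto
  have card: "card ?S = CARD('n)" using True by (rule card_image)
  have fin: "finite ?S" "?S \<noteq> {}" by simp_all
  obtain i j where i: "Max ?S = x $ i" and j: "Min ?S = x $ j"
    using Max_in[OF fin] Min_in[OF fin] by blast
  have "Max ?S \<noteq> Min ?S"
  proof
    assume eq: "Max ?S = Min ?S"
    have "a = Max ?S" if "a \<in> ?S" for a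
      using Max_ge[OF fin(1) that] Min_le[OF fin(1) that] unfolding eq by (rule antisym)
    then have "?S \<subseteq> {Max ?S}" by blast
    then have "card ?S \<le> card {Max ?S}" by (intro card_mono) auto
    with card d show False by simp
  qed
  then have "i \<noteq> j" unfolding i j by blast
  then have "Max ?S - Min ?S \<le> f_max x" unfolding i j using le_f_max[of i j x] by linarith
  with spread show ?thesis unfolding card by linarith
qed

section \<open>A separable majorant of the maximal distance\<close>

definition end_excess :: "real \<Rightarrow> real \<Rightarrow> real" where
  "end_excess s u = max 0 (s - u) + max 0 (u - (1 - s))"

text \<open>
  The coordinate with the larger value exceeds \<open>1 - s\<close> by at most its upper excess, the one with the
  smaller value falls below \<open>s\<close> by at most its lower excess, and all other excesses are
  nonnegative.
\<close>

lemma f_max_le_separable: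
  fixes x :: "real ^ 'n::finite"
  assumes d: "CARD('n) \<ge> 2"
  shows "f_max x \<le> 1 - 2 * s + (\<Sum>i\<in>UNIV. end_excess s (x $ i))"
proof -
  have diff: "x $ i - x $ j \<le> 1 - 2 * s + (\<Sum>i\<in>UNIV. end_excess s (x $ i))" if "i \<noteq> j" for i j
  proof -
    have "x $ i - x $ j \<le> 1 - 2 * s + (end_excess s (x $ i) + end_excess s (x $ j))"
    proof -
      have "x $ i - (1 - s) \<le> end_excess s (x $ i)" "s - x $ j \<le> end_excess s (x $ j)"
        by (simp_all add: end_excess_def)
      then show ?thesis by linarith
    qed
    also have "end_excess s (x $ i) + end_excess s (x $ j) = (\<Sum>k\<in>{i, j}. end_excess s (x $ k))"
      using that by simp
    also have "\<dots> \<le> (\<Sum>k\<in>UNIV. end_excess s (x $ k))"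
      by (rule sum_mono2) (auto simp: end_excess_def)
    finally show ?thesis by simp
  qed
  obtain i j where ij: "i \<noteq> j" "f_max x = \<bar>x $ i - x $ j\<bar>"
    using f_max_attained[OF d] by blast
  show ?thesis using diff[OF ij(1)] diff[OF ij(1)[symmetric]] ij(2) by linarith
qed

lemma space_lambda01: "space lambda01 = {0..1}"
  by (simp add: lambda01_def space_restrict_space)

lemma borel_measurable_lambda01I:
  "f \<in> borel_measurable borel \<Longrightarrow> f \<in> borel_measurable lambda01"
  unfolding lambda01_def by (intro measurable_restrict_space1) simp

lemma prob_space_lambda01: "prob_space lambda01"
  by (rule prob_spaceI)
     (simp add: lambda01_def space_restrict_space emeasure_restrict_space)

lemma integral_lambda01:
  "integral\<^sup>L lambda01 f = (\<integral>u. indicator {0..1} u * f u \<partial>lborel)" for f :: "real \<Rightarrow> real"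
  unfolding lambda01_def by (subst integral_restrict_space) auto

lemma integral_lower_excess:
  assumes "0 \<le> s" "s \<le> 1"
  shows "(\<integral>u. max 0 (s - u) \<partial>lambda01) = s\<^sup>2 / 2"
proof -
  have "(\<lambda>u. indicator {0..1} u * max 0 (s - u)) = (\<lambda>u. (s - u) * indicator {0..s} u)"
    using assms by (auto simp: indicator_def max_def)
  moreover have "has_bochner_integral lborel (\<lambda>u. (s - u) * indicator {0..s} u)
      (- (s - s)\<^sup>2 / 2 - (- (s - 0)\<^sup>2 / 2))"
    using assms
    by (intro has_bochner_integral_FTC_Icc_nonneg)
       (auto intro!: derivative_eq_intros simp: field_simps)
  ultimately show ?thesis
    unfolding integral_lambda01 by (simp add: has_bochner_integral_integral_eq)
qed

lemma integral_upper_excess: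
  assumes "0 \<le> s" "s \<le> 1"
  shows "(\<integral>u. max 0 (u - (1 - s)) \<partial>lambda01) = s\<^sup>2 / 2"
proof -
  have "(\<lambda>u. indicator {0..1} u * max 0 (u - (1 - s)))
      = (\<lambda>u. (u - (1 - s)) * indicator {1 - s..1} u)"
    using assms by (auto simp: indicator_def max_def)
  moreover have "has_bochner_integral lborel (\<lambda>u. (u - (1 - s)) * indicator {1 - s..1} u)
      ((1 - (1 - s))\<^sup>2 / 2 - ((1 - s) - (1 - s))\<^sup>2 / 2)"
    using assms
    by (intro has_bochner_integral_FTC_Icc_nonneg) (auto intro!: derivative_eq_intros)
  ultimately show ?thesis
    unfolding integral_lambda01 by (simp add: has_bochner_integral_integral_eq)
qed

lemma integral_end_excess:
  assumes "0 \<le> s" "s \<le> 1"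
  shows "integral\<^sup>L lambda01 (end_excess s) = s\<^sup>2"
proof -
  interpret prob_space lambda01 by (rule prob_space_lambda01)
  have "integrable lambda01 (\<lambda>u. max 0 (s - u))"
    using assms by (intro integrable_const_bound[where B = 1] borel_measurable_lambda01I)
      (auto simp: space_lambda01 intro!: AE_I2)
  moreover have "integrable lambda01 (\<lambda>u. max 0 (u - (1 - s)))"
    using assms by (intro integrable_const_bound[where B = 1] borel_measurable_lambda01I)
      (auto simp: space_lambda01 intro!: AE_I2)
  ultimately show ?thesis
    unfolding end_excess_def
    by (simp add: integral_lower_excess[OF assms] integral_upper_excess[OF assms])
qed

section \<open>Integrals against stochastic measures\<close>

lemma d_stochastic_space:
  fixes \<theta> :: "(real ^ 'n::finite) measure"
  assumes "d_stochastic \<theta>"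
  shows "space \<theta> = unit_cube"
proof -
  have "sets \<theta> = sets (restrict_space borel unit_cube)"
    using assms by (simp add: d_stochastic_def)
  from sets_eq_imp_space_eq[OF this] show ?thesis by (simp add: space_restrict_space)
qed

lemma d_stochastic_borel_measurable:
  fixes \<theta> :: "(real ^ 'n::finite) measure"
  assumes "d_stochastic \<theta>" "f \<in> borel_measurable borel"
  shows "f \<in> borel_measurable \<theta>"
proof -
  have "sets \<theta> = sets (restrict_space borel unit_cube)"
    using assms by (simp add: d_stochastic_def)
  then show ?thesis
    using measurable_restrict_space1[OF assms(2)] measurable_cong_sets[OF _ refl] by blast
qed

lemma borel_measurable_coordinate [measurable]:
  "(\<lambda>x :: real ^ 'n::finite. x $ i) \<in> borel_measurable borel"
  by (intro borel_measurable_continuous_onI continuous_intros)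

lemma borel_measurable_f_min [measurable]:
  "(f_min :: real ^ 'n::finite \<Rightarrow> real) \<in> borel_measurable borel"
proof -
  have "(\<lambda>x :: real ^ 'n. f_min x) \<in> borel_measurable borel"
    unfolding f_min_def pairwise_distances_eq_image
    by (intro borel_measurable_Min borel_measurable_abs borel_measurable_diff
        borel_measurable_coordinate) simp
  then show ?thesis .
qed

lemma borel_measurable_f_max [measurable]:
  "(f_max :: real ^ 'n::finite \<Rightarrow> real) \<in> borel_measurable borel"
proof -
  have "(\<lambda>x :: real ^ 'n. f_max x) \<in> borel_measurable borel"
    unfolding f_max_def pairwise_distances_eq_image
    by (intro borel_measurable_Max borel_measurable_abs borel_measurable_diff
        borel_measurable_coordinate) simp
  then show ?thesis .
qed

lemma abs_coordinate_diff_le_1: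
  fixes x :: "real ^ 'n::finite"
  assumes "x \<in> unit_cube"
  shows "\<bar>x $ i - x $ j\<bar> \<le> 1"
proof -
  have "0 \<le> x $ i" "x $ i \<le> 1" "0 \<le> x $ j" "x $ j \<le> 1"
    using assms by (auto simp: unit_cube_def)
  then show ?thesis by linarith
qed

lemma integrable_f_min:
  fixes \<theta> :: "(real ^ 'n::finite) measure"
  assumes d: "CARD('n) \<ge> 2" and \<theta>: "d_stochastic \<theta>"
  shows "integrable \<theta> f_min"
proof -
  interpret prob_space \<theta> using \<theta> by (simp add: d_stochastic_def)
  have "norm (f_min x) \<le> 1" if "x \<in> space \<theta>" for x
  proof -
    obtain i j where "f_min x = \<bar>x $ i - x $ j\<bar>"
      using f_min_attained[OF d] by blast
    then show ?thesis
      using abs_coordinate_diff_le_1[of x i j] that by (simp add: d_stochastic_space[OF \<theta>])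
  qed
  then show ?thesis
    by (intro integrable_const_bound[where B = 1] AE_I2
        d_stochastic_borel_measurable[OF \<theta>] borel_measurable_f_min)
qed

lemma integrable_f_max:
  fixes \<theta> :: "(real ^ 'n::finite) measure"
  assumes d: "CARD('n) \<ge> 2" and \<theta>: "d_stochastic \<theta>"
  shows "integrable \<theta> f_max"
proof -
  interpret prob_space \<theta> using \<theta> by (simp add: d_stochastic_def)
  have "norm (f_max x) \<le> 1" if "x \<in> space \<theta>" for x
  proof -
    obtain i j where "f_max x = \<bar>x $ i - x $ j\<bar>"
      using f_max_attained[OF d] by blast
    then show ?thesis
      using abs_coordinate_diff_le_1[of x i j] that by (simp add: d_stochastic_space[OF \<theta>])
  qed
  then show ?thesis
    by (intro integrable_const_bound[where B = 1] AE_I2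
        d_stochastic_borel_measurable[OF \<theta>] borel_measurable_f_max)
qed

lemma d_stochastic_integral_coordinate:
  fixes \<theta> :: "(real ^ 'n::finite) measure" and g :: "real \<Rightarrow> real"
  assumes \<theta>: "d_stochastic \<theta>" and g: "g \<in> borel_measurable borel"
  shows "(\<integral>x. g (x $ i) \<partial>\<theta>) = integral\<^sup>L lambda01 g"
proof -
  have "(\<lambda>x. x $ i) \<in> measurable \<theta> lambda01"
    unfolding lambda01_def
    using d_stochastic_borel_measurable[OF \<theta> borel_measurable_coordinate]
    by (intro measurable_restrict_space2)
       (auto simp: d_stochastic_space[OF \<theta>] unit_cube_def)
  from integral_distr[OF this borel_measurable_lambda01I[OF g]]
  show ?thesis using \<theta> by (simp add: d_stochastic_def)
qed

lemma integral_f_max_le: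
  fixes \<theta> :: "(real ^ 'n::finite) measure"
  assumes d: "CARD('n) \<ge> 2" and \<theta>: "d_stochastic \<theta>"
  shows "integral\<^sup>L \<theta> f_max \<le> (real CARD('n) - 1) / real CARD('n)"
proof -
  interpret prob_space \<theta> using \<theta> by (simp add: d_stochastic_def)
  \<comment> \<open>The majorant is valid for every \<open>s\<close>. Its integral is \<open>1 - 2 * s + d * s\<^sup>2\<close>, which is
      smallest at \<open>s = 1 / d\<close>.\<close>
  define s where "s = 1 / real CARD('n)"
  have s: "0 \<le> s" "s \<le> 1" using d by (auto simp: s_def)
  have meas [measurable]: "end_excess s \<in> borel_measurable borel"
    unfolding end_excess_def by measurable
  have int: "integrable \<theta> (\<lambda>x. end_excess s (x $ i))" for i
  proof (rule integrable_const_bound[where B = 2])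
    show "(\<lambda>x. end_excess s (x $ i)) \<in> borel_measurable \<theta>"
      by (rule d_stochastic_borel_measurable[OF \<theta>]) measurable
    have "norm (end_excess s (x $ i)) \<le> 2" if "x \<in> space \<theta>" for x
    proof -
      have "0 \<le> x $ i" "x $ i \<le> 1"
        using that by (auto simp: d_stochastic_space[OF \<theta>] unit_cube_def)
      with s have "max 0 (s - x $ i) \<le> 1" "max 0 (x $ i - (1 - s)) \<le> 1" by simp_all
      then show ?thesis by (simp add: end_excess_def)
    qed
    then show "AE x in \<theta>. norm (end_excess s (x $ i)) \<le> 2" by (rule AE_I2)
  qed
  have "integral\<^sup>L \<theta> f_max \<le> (\<integral>x. 1 - 2 * s + (\<Sum>i\<in>UNIV. end_excess s (x $ i)) \<partial>\<theta>)"
    using int by (intro integral_mono integrable_f_max[OF d \<theta>] f_max_le_separable[OF d]) auto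
  also have "\<dots> = 1 - 2 * s + (\<Sum>i\<in>(UNIV :: 'n set). integral\<^sup>L lambda01 (end_excess s))"
    using int by (simp add: prob_space d_stochastic_integral_coordinate[OF \<theta> meas])
  also have "\<dots> = 1 - 2 * s + real CARD('n) * s\<^sup>2"
    by (simp add: integral_end_excess[OF s])
  also have "\<dots> = (real CARD('n) - 1) / real CARD('n)"
    using d by (simp add: s_def field_simps power2_eq_square)
  finally show ?thesis .
qed

section \<open>Rotations of the unit interval\<close>

lemma emeasure_lborel_vimage_plus:
  fixes c :: real
  assumes "B \<in> sets borel"
  shows "emeasure lborel ((+) c -` B) = emeasure lborel B"
proof -
  have "emeasure (distr lborel borel ((+) c)) B = emeasure lborel ((+) c -` B)"
    using assms by (subst emeasure_distr) auto
  then show ?thesis by (simp only: lborel_distr_plus)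
qed

lemma borel_measurable_frac_plus [measurable]:
  "(\<lambda>u :: real. frac (u + a)) \<in> borel_measurable borel"
  unfolding frac_def by measurable

lemma frac_in_unit: "frac (u :: real) \<in> {0..1}"
  using frac_lt_1[of u] by (simp add: less_imp_le)

lemma measurable_lambda01_rotation:
  "(\<lambda>u. frac (u + a)) \<in> measurable lambda01 lambda01"
proof -
  have "(\<lambda>u. frac (u + a)) \<in> borel_measurable lambda01"
    by (intro borel_measurable_lambda01I borel_measurable_frac_plus)
  then show ?thesis
    using frac_in_unit by (subst (2) lambda01_def) (intro measurable_restrict_space2, auto)
qed

text \<open>
  A rotation cuts the interval into two pieces and translates each of them. The right end point,
  which is sent to the same place as \<open>0\<close>, is a null set and is left out on both sides.
\<close>

lemma distr_lambda01_rotation: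
  assumes a: "0 \<le> a" "a < 1"
  shows "distr lambda01 lambda01 (\<lambda>u. frac (u + a)) = lambda01"
proof (rule measure_eqI)
  let ?T = "\<lambda>u :: real. frac (u + a)"
  fix A assume "A \<in> sets (distr lambda01 lambda01 ?T)"
  then have A01: "A \<in> sets lambda01" by simp
  then have A [measurable]: "A \<in> sets borel" and sub: "A \<subseteq> {0..1}"
    by (auto simp: lambda01_def sets_restrict_space_iff)
  have [measurable]: "?T -` A \<in> sets borel"
    using measurable_sets[OF borel_measurable_frac_plus A] by simp
  have em: "emeasure lambda01 X = emeasure lborel X" if "X \<subseteq> {0..1}" for X
    unfolding lambda01_def using that by (intro emeasure_restrict_space) auto
  have "emeasure (distr lambda01 lambda01 ?T) A = emeasure lborel (?T -` A \<inter> {0..1})"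
    using A01 measurable_lambda01_rotation
    by (simp add: emeasure_distr space_lambda01 em)
  also have "\<dots> = emeasure lborel (?T -` A \<inter> {0..<1})"
  proof (rule emeasure_eq_AE)
    show "AE u in lborel. u \<in> ?T -` A \<inter> {0..1} \<longleftrightarrow> u \<in> ?T -` A \<inter> {0..<1}"
      using AE_lborel_singleton[of "1::real"] by (rule eventually_mono) auto
  qed auto
  also have "?T -` A \<inter> {0..<1} = (+) a -` (A \<inter> {a..<1}) \<union> (+) (a - 1) -` (A \<inter> {0..<a})"
  proof -
    have left: "frac (u + a) = a + u" if "0 \<le> u" "u < 1 - a" for u
      using that a by (simp add: frac_unique_iff)
    have right: "frac (u + a) = a - 1 + u" if "u < 1" "1 - a \<le> u" for u
      using that a by (simp add: frac_unique_iff)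
    show ?thesis
    proof (rule set_eqI)
      fix u
      show "u \<in> ?T -` A \<inter> {0..<1}
          \<longleftrightarrow> u \<in> (+) a -` (A \<inter> {a..<1}) \<union> (+) (a - 1) -` (A \<inter> {0..<a})"
      proof (cases "u < 1 - a")
        case True
        then show ?thesis using left[of u] a by (auto simp: add.commute[of u a])
      next
        case False
        then show ?thesis using right[of u] a by auto
      qed
    qed
  qed
  also have "emeasure lborel \<dots> = emeasure lborel ((+) a -` (A \<inter> {a..<1}))
      + emeasure lborel ((+) (a - 1) -` (A \<inter> {0..<a}))"
    by (intro plus_emeasure[symmetric]) (auto simp: measurable_sets_borel)
  also have "\<dots> = emeasure lborel (A \<inter> {a..<1}) + emeasure lborel (A \<inter> {0..<a})"
    by (intro arg_cong2[where f = "(+)"] emeasure_lborel_vimage_plus) auto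
  also have "\<dots> = emeasure lborel ((A \<inter> {a..<1}) \<union> (A \<inter> {0..<a}))"
    by (rule plus_emeasure) auto
  also have "\<dots> = emeasure lborel A"
  proof (rule emeasure_eq_AE)
    show "AE u in lborel. u \<in> (A \<inter> {a..<1}) \<union> (A \<inter> {0..<a}) \<longleftrightarrow> u \<in> A"
      using AE_lborel_singleton[of "1::real"]
    proof (rule eventually_mono)
      fix u :: real assume "u \<noteq> 1"
      then have "0 \<le> u \<and> u < 1" if "u \<in> A" using subsetD[OF sub that] by simp
      then show "u \<in> (A \<inter> {a..<1}) \<union> (A \<inter> {0..<a}) \<longleftrightarrow> u \<in> A" by auto
    qed
  qed auto
  also have "\<dots> = emeasure lambda01 A"
    using sub by (simp add: em)
  finally show "emeasure (distr lambda01 lambda01 ?T) A = emeasure lambda01 A" .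
qed simp

section \<open>The extremal measure\<close>

text \<open>
  The enumeration \<open>e\<close> of the coordinates is arbitrary: the functions of interest are symmetric.
\<close>

definition rotated_point :: "('n::finite \<Rightarrow> nat) \<Rightarrow> real \<Rightarrow> real ^ 'n" where
  "rotated_point e u = (\<chi> i. frac (u + real (e i) / real CARD('n)))"

definition rotation_measure :: "('n::finite \<Rightarrow> nat) \<Rightarrow> (real ^ 'n) measure" where
  "rotation_measure e = distr lambda01 (restrict_space borel unit_cube) (rotated_point e)"

lemma measurable_rotated_point:
  "rotated_point e \<in> measurable lambda01 (restrict_space borel (unit_cube :: (real ^ 'n::finite) set))"
proof -
  have "(\<lambda>u. rotated_point e u \<bullet> b) \<in> borel_measurable borel" if b: "b \<in> Basis" for b
  proof -
    obtain i where "b = axis i 1" using b by (auto simp: Basis_vec_def)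
    then have "(\<lambda>u. rotated_point e u \<bullet> b) = (\<lambda>u. frac (u + real (e i) / real CARD('n)))"
      by (simp add: inner_axis rotated_point_def)
    then show ?thesis by (simp only: borel_measurable_frac_plus)
  qed
  then have "rotated_point e \<in> borel_measurable borel"
    by (intro iffD2[OF borel_measurable_euclidean_space]) blast
  then have "rotated_point e \<in> borel_measurable lambda01"
    by (rule borel_measurable_lambda01I)
  moreover have "rotated_point e u \<in> unit_cube" for u
    by (simp add: rotated_point_def unit_cube_def less_imp_le[OF frac_lt_1])
  then have "rotated_point e \<in> space lambda01 \<rightarrow> unit_cube" by blast
  ultimately show ?thesis by (rule measurable_restrict_space2[rotated])
qed

lemma d_stochastic_rotation_measure:
  fixes e :: "'n::finite \<Rightarrow> nat"
  assumes e: "\<And>i. e i < CARD('n)"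
  shows "d_stochastic (rotation_measure e)"
  unfolding d_stochastic_def
proof (intro conjI allI)
  interpret prob_space lambda01 by (rule prob_space_lambda01)
  show "prob_space (rotation_measure e)"
    unfolding rotation_measure_def by (rule prob_space_distr[OF measurable_rotated_point])
  show "sets (rotation_measure e) = sets (restrict_space borel unit_cube)"
    by (simp add: rotation_measure_def)
  fix i
  have "(\<lambda>x :: real ^ 'n. x $ i) \<in> measurable (restrict_space borel unit_cube) lambda01"
    unfolding lambda01_def
    by (intro measurable_restrict_space2 measurable_restrict_space1)
       (auto simp: space_restrict_space unit_cube_def)
  then have "distr (rotation_measure e) lambda01 (\<lambda>x. x $ i)
      = distr lambda01 lambda01 (\<lambda>u. frac (u + real (e i) / real CARD('n)))"
    unfolding rotation_measure_def
    by (subst distr_distr[OF _ measurable_rotated_point]) (simp_all add: comp_def rotated_point_def)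
  also have "\<dots> = lambda01"
    using e by (intro distr_lambda01_rotation) auto
  finally show "distr (rotation_measure e) lambda01 (\<lambda>x. x $ i) = lambda01" .
qed

text \<open>
  The difference of two coordinates is \<open>n/d\<close> with \<open>n\<close> an integer that is congruent modulo \<open>d\<close> to
  the difference of two distinct indices below \<open>d\<close>. Hence \<open>n\<close> is not zero.
\<close>

lemma f_min_rotated_point:
  fixes e :: "'n::finite \<Rightarrow> nat"
  assumes d: "CARD('n) \<ge> 2" and inj: "inj e" and e: "\<And>i. e i < CARD('n)"
  shows "1 / real CARD('n) \<le> f_min (rotated_point e u)"
proof -
  let ?d = "int CARD('n)"
  obtain i j where ij: "i \<noteq> j"
    and f: "f_min (rotated_point e u) = \<bar>rotated_point e u $ i - rotated_point e u $ j\<bar>"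
    using f_min_attained[OF d] by blast
  define k where
    "k = \<lfloor>u + real (e i) / real CARD('n)\<rfloor> - \<lfloor>u + real (e j) / real CARD('n)\<rfloor>"
  define n where "n = int (e i) - int (e j) - k * ?d"
  have "rotated_point e u $ i - rotated_point e u $ j = of_int n / real CARD('n)"
    by (simp add: rotated_point_def frac_def n_def k_def diff_divide_distrib)
  then have "f_min (rotated_point e u) = of_int \<bar>n\<bar> / real CARD('n)"
    by (simp add: f)
  moreover have "n \<noteq> 0"
  proof
    assume "n = 0"
    then have "?d dvd int (e i) - int (e j)" by (simp add: n_def)
    moreover have "\<bar>int (e i) - int (e j)\<bar> < ?d" using e[of i] e[of j] by linarith
    ultimately have "int (e i) - int (e j) = 0"
      using dvd_imp_le_int[of "int (e i) - int (e j)" ?d] by linarith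
    then have "e i = e j" by simp
    with inj ij show False by (auto dest: injD)
  qed
  then have "1 \<le> \<bar>n\<bar>" by linarith
  ultimately show ?thesis by (simp add: divide_right_mono)
qed

lemma integral_f_min_rotation_measure:
  fixes e :: "'n::finite \<Rightarrow> nat"
  assumes d: "CARD('n) \<ge> 2" and inj: "inj e" and e: "\<And>i. e i < CARD('n)"
  shows "1 / real CARD('n) \<le> integral\<^sup>L (rotation_measure e) f_min"
proof -
  interpret prob_space lambda01 by (rule prob_space_lambda01)
  have "integrable (rotation_measure e) f_min"
    by (rule integrable_f_min[OF d d_stochastic_rotation_measure[OF e]])
  then have int: "integrable lambda01 (\<lambda>u. f_min (rotated_point e u))"
    unfolding rotation_measure_def by (rule integrable_distr[OF measurable_rotated_point])
  have "1 / real CARD('n) = (\<integral>u. 1 / real CARD('n) \<partial>lambda01)"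
    by (simp add: prob_space)
  also have "\<dots> \<le> (\<integral>u. f_min (rotated_point e u) \<partial>lambda01)"
    using f_min_rotated_point[OF d inj e] by (intro integral_mono int) auto
  also have "\<dots> = integral\<^sup>L (rotation_measure e) f_min"
    unfolding rotation_measure_def
    by (rule integral_distr[OF measurable_rotated_point, symmetric])
       (intro measurable_restrict_space1 borel_measurable_f_min)
  finally show ?thesis .
qed

lemma integral_f_min_le_f_max:
  fixes \<theta> :: "(real ^ 'n::finite) measure"
  assumes d: "CARD('n) \<ge> 2" and \<theta>: "d_stochastic \<theta>"
  shows "(real CARD('n) - 1) * integral\<^sup>L \<theta> f_min \<le> integral\<^sup>L \<theta> f_max"
proof -
  have "(\<integral>x. (real CARD('n) - 1) * f_min x \<partial>\<theta>) \<le> integral\<^sup>L \<theta> f_max"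
    using f_min_le_f_max[OF d]
    by (intro integral_mono integrable_mult_right integrable_f_min[OF d \<theta>]
        integrable_f_max[OF d \<theta>])
  then show ?thesis by simp
qed

lemma C_eqI:
  assumes "\<theta> \<in> P_ds" "c \<le> integral\<^sup>L \<theta> f"
    and le: "\<And>\<theta>. \<theta> \<in> P_ds \<Longrightarrow> integral\<^sup>L \<theta> f \<le> c"
  shows "C f = c"
proof -
  have "integral\<^sup>L \<theta> f = c" using assms by (intro antisym)
  then show ?thesis
    unfolding C_def using assms(1) le by (intro cSup_eq_maximum) auto
qed

theorem theorem4p1:
  assumes "CARD('n::finite) \<ge> 2"
  shows "C (f_min :: real ^ 'n \<Rightarrow> real) = 1 / real CARD('n) \<and>
         C (f_max :: real ^ 'n \<Rightarrow> real) = (real CARD('n) - 1) / real CARD('n)"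
proof -
  let ?d = "real CARD('n)"
  have d1: "0 < ?d - 1" using assms by simp
  obtain e :: "'n \<Rightarrow> nat" where "bij_betw e UNIV {0..<CARD('n)}"
    using ex_bij_betw_finite_nat[OF finite_class.finite_UNIV] by blast
  then have inj: "inj e" and e: "e i < CARD('n)" for i
    using bij_betw_imp_inj_on bij_betwE by (blast, fastforce)
  let ?\<theta> = "rotation_measure e"
  have \<theta>: "d_stochastic ?\<theta>" by (rule d_stochastic_rotation_measure[OF e])
  then have P: "?\<theta> \<in> P_ds" by (simp add: P_ds_def)
  have low: "1 / ?d \<le> integral\<^sup>L ?\<theta> f_min"
    by (rule integral_f_min_rotation_measure[OF assms inj e])
  have "(?d - 1) / ?d \<le> (?d - 1) * integral\<^sup>L ?\<theta> f_min"
    using mult_left_mono[OF low, of "?d - 1"] d1 by simp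
  also have "\<dots> \<le> integral\<^sup>L ?\<theta> f_max"
    by (rule integral_f_min_le_f_max[OF assms \<theta>])
  finally have low': "(?d - 1) / ?d \<le> integral\<^sup>L ?\<theta> f_max" .
  have up: "integral\<^sup>L \<theta> f_max \<le> (?d - 1) / ?d" if "\<theta> \<in> P_ds" for \<theta> :: "(real ^ 'n) measure"
    using that by (intro integral_f_max_le[OF assms]) (simp add: P_ds_def)
  have up': "integral\<^sup>L \<theta> f_min \<le> 1 / ?d" if "\<theta> \<in> P_ds" for \<theta> :: "(real ^ 'n) measure"
  proof -
    have "(?d - 1) * integral\<^sup>L \<theta> f_min \<le> (?d - 1) * (1 / ?d)"
      using integral_f_min_le_f_max[OF assms, of \<theta>] up[OF that] that by (simp add: P_ds_def)
    then show ?thesis using d1 by (simp only: mult_le_cancel_left_pos)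
  qed
  show ?thesis using C_eqI[OF P low up'] C_eqI[OF P low' up] by blast
qed

end
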